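(* Let $E$ be an effect algebra satisfying the Riesz Decomposition Property (RDP) and the countable interpolation property. Then every $\sigma$-convex combination of extremal states on $E$ is a Jauch-Piron state.
   Context: An effect algebra is a partial algebra $(E;+,0,1)$ with a partially defined binary operation $+$ and constants $0,1$ such that for all $a,b,c\in E$: (i) $a+b$ is defined iff $b+a$ is, and then $a+b=b+a$; (ii) $a+b$ and $(a+b)+c$ are defined iff $b+c$ and $a+(b+c)$ are, and then $(a+b)+c=a+(b+c)$; (iii) for each $a$ there is a unique $a'$ with $a+a'=1$; (iv) if $a+1$ is defined then $a=0$. The partial order is $a\le b$ iff $a+c=b$ for some $c\in E$. $E$ satisfies (RDP) if $x_1+x_2=y_1+y_2$ implies there are $c_{11},c_{12},c_{21},c_{22}\in E$ with $x_1=c_{11}+c_{12}$, $x_2=c_{21}+c_{22}$, $y_1=c_{11}+c_{21}$, $y_2=c_{12}+c_{22}$. A poset $E$ satisfies the countable interpolation property if for any two sequences $\{a_i\}$, $\{b_j\}$ in $E$ with $a_i\le b_j$ for all $i,j$, there is $c\in E$ with $a_i\le c\le b_j$ for all $i,j$. A state on $E$ is a map $s:E\to[0,1]$ with $s(1)=1$ and $s(a+b)=s(a)+s(b)$ whenever $a+b$ is defined. A state $s$ is extremal if $s=\lambda s_1+(1-\lambda)s_2$ with $\lambda\in(0,1)$ and states $s_1,s_2$ implies $s=s_1=s_2$. A $\sigma$-convex combination of a finite or countable set $\{s_n\}$ of states is a state $s=\sum_n\lambda_ns_n$ with $\lambda_n\ge0$, $\sum_n\lambda_n=1$. A state $s$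 is Jauch-Piron if for all $a,b\in E$ with $s(a)=s(b)=1$ there is $c\in E$ with $c\le a$, $c\le b$ and $s(c)=1$. *)

theory Defs
  imports "HOL-Analysis.Analysis"
begin

text \<open>
  The underlying set of an effect algebra is the whole type \<open>'a\<close>. The partial operation is
  option-valued: \<open>oplus a b = None\<close> means that the sum of \<open>a\<close> and \<open>b\<close> is undefined.
  An equation between options thus says that one side is defined iff the other one is, and that
  they then agree; in \<open>assoc\<close>, each side is defined iff both its inner and its outer sum are.
\<close>

locale effect_algebra =
  fixes oplus :: "'a \<Rightarrow> 'a \<Rightarrow> 'a option"
    and zero :: 'a
    and one :: 'a
  assumes commute: "oplus a b = oplus b a"
    and assoc: "Option.bind (oplus a b) (\<lambda>d. oplus d c) = Option.bind (oplus b c) (\<lambda>d. oplus a d)"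
    and ex1_orthosupplement: "\<exists>!a'. oplus a a' = Some one"
    and zero_one: "oplus a one \<noteq> None \<Longrightarrow> a = zero"
begin

definition le :: "'a \<Rightarrow> 'a \<Rightarrow> bool" where
  "le a b \<longleftrightarrow> (\<exists>c. oplus a c = Some b)"

definition RDP :: bool where
  "RDP \<longleftrightarrow>
    (\<forall>x1 x2 y1 y2 z. oplus x1 x2 = Some z \<and> oplus y1 y2 = Some z \<longrightarrow>
      (\<exists>c11 c12 c21 c22.
        oplus c11 c12 = Some x1 \<and> oplus c21 c22 = Some x2 \<and>
        oplus c11 c21 = Some y1 \<and> oplus c12 c22 = Some y2))"

definition countable_interpolation :: bool where
  "countable_interpolation \<longleftrightarrow>
    (\<forall>(a :: nat \<Rightarrow> 'a) (b :: nat \<Rightarrow> 'a). (\<forall>i j. le (a i) (b j)) \<longrightarrow>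
      (\<exists>c. \<forall>i j. le (a i) c \<and> le c (b j)))"

definition state :: "('a \<Rightarrow> real) \<Rightarrow> bool" where
  "state s \<longleftrightarrow> (\<forall>a. s a \<in> {0..1}) \<and> s one = 1 \<and>
    (\<forall>a b c. oplus a b = Some c \<longrightarrow> s c = s a + s b)"

definition extremal_state :: "('a \<Rightarrow> real) \<Rightarrow> bool" where
  "extremal_state s \<longleftrightarrow> state s \<and>
    (\<forall>s1 s2. \<forall>l\<in>{0<..<1}. state s1 \<and> state s2 \<and> s = (\<lambda>a. l * s1 a + (1 - l) * s2 a) \<longrightarrow>
      s = s1 \<and> s = s2)"

text \<open>The weights are indexed by the states themselves, and \<open>countable\<close> includes finite sets.\<close>

definition sigma_convex_combination :: "('a \<Rightarrow> real) set \<Rightarrow> ('a \<Rightarrow> real) \<Rightarrow> bool" where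
  "sigma_convex_combination S s \<longleftrightarrow> state s \<and> countable S \<and> (\<forall>t\<in>S. state t) \<and>
    (\<exists>w. (\<forall>t\<in>S. 0 \<le> w t) \<and> (w has_sum 1) S \<and> (\<forall>a. ((\<lambda>t. w t * t a) has_sum s a) S))"

definition jauch_piron :: "('a \<Rightarrow> real) \<Rightarrow> bool" where
  "jauch_piron s \<longleftrightarrow> state s \<and>
    (\<forall>a b. s a = 1 \<and> s b = 1 \<longrightarrow> (\<exists>c. le c a \<and> le c b \<and> s c = 1))"

end

end

theory Submission
  imports Defs
begin

text \<open>
  Refine \<open>a + a' = 1 = b + b'\<close> by (RDP). The common part \<open>c\<close> of \<open>a\<close> and \<open>b\<close> differs from \<open>a\<close>
  by an element below \<open>b'\<close>, on which the state vanishes because \<open>s b = 1\<close>; hence \<open>s c = s a = 1\<close>.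
\<close>

lemma (in effect_algebra) RDP_imp_jauch_piron:
  assumes RDP and s: "state s"
  shows "jauch_piron s"
  unfolding jauch_piron_def
proof (intro conjI allI impI s)
  fix a b
  assume ab: "s a = 1 \<and> s b = 1"
  obtain a' b' where "oplus a a' = Some one" and b': "oplus b b' = Some one"
    using ex1_orthosupplement by metis
  \<comment> \<open>The rows \<open>c\<close>, \<open>d\<close> and \<open>e\<close>,
    \<open>f\<close> of the refinement matrix sum to \<open>a\<close> and \<open>a'\<close>, its
    columns to \<open>b\<close> and \<open>b'\<close>.\<close>
  then obtain c d e f where *: "oplus c d = Some a" "oplus c e = Some b" "oplus d f = Some b'"
    using \<open>RDP\<close> unfolding RDP_def by metis
  have add: "s z = s x + s y" if "oplus x y = Some z" for x y z
    using s that unfolding state_def by blast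
  have nonneg: "0 \<le> s x" for x
    using s unfolding state_def by auto
  have "s one = 1"
    using s unfolding state_def by blast
  \<comment> \<open>Additivity on \<open>b + b' = 1\<close> gives
    \<open>s d + s f = s b' = 0\<close>; nonnegativity of both terms then forces
    \<open>s d = 0\<close>.\<close>
  then have "s c = 1"
    using ab add[OF b'] add[OF *(1)] add[OF *(3)] nonneg[of d] nonneg[of f] by linarith
  then show "\<exists>c. le c a \<and> le c b \<and> s c = 1"
    using * unfolding le_def by blast
qed

theorem proposition5p4:
  fixes oplus :: "'a \<Rightarrow> 'a \<Rightarrow> 'a option"
    and zero one :: 'a
    and S :: "('a \<Rightarrow> real) set"
    and s :: "'a \<Rightarrow> real"
  assumes "effect_algebra oplus zero one"
    and "effect_algebra.RDP oplus"
    and "effect_algebra.countable_interpolation oplus"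
    and "\<forall>t\<in>S. effect_algebra.extremal_state oplus one t"
    and "effect_algebra.sigma_convex_combination oplus one S s"
  shows "effect_algebra.jauch_piron oplus one s"
proof -
  interpret effect_algebra oplus zero one by fact
  \<comment> \<open>Being a state is part of \<open>sigma_convex_combination\<close>, so the lemma
    applies to \<open>s\<close> itself.\<close>
  show ?thesis
    using assms(2,5) RDP_imp_jauch_piron unfolding sigma_convex_combination_def by blast
qed

end
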